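(* Consider the following three assertions. (A) For all positive integers $I$ and $J$: if $A$ is any set of positive integers such that $|A| = H(I,J)$, then there are $I$ pairwise disjoint Golomb rulers, each being a $J$-element subset of $A$. (B) For all integers $I\ge 1$ and $J\ge 3$: $H(I+1,J)\le H(I,J)+J$. (C) For all positive integers $I_0$ and $J$: if $H(I_0,J)=I_0J$, then $H(I,J)=IJ$ for any integer $I>I_0$. Then: (1) if (A) holds, then (B) holds; (2) if (B) holds, then (C) holds; (3) if (A) holds, then (C) holds.
   Context: A Golomb ruler is a set $\{a_1,\dots,a_k\}$ of $k$ distinct non-negative integers such that all the differences $a_i-a_j$, $i\neq j$, are distinct. An $(I,J,n)$-DGR is a set of $I$ pairwise disjoint Golomb rulers, each being a $J$-element subset of $\{1,2,\dots,n\}$. For positive integers $I,J$, $H(I,J)$ is the least positive integer $n$ such that there is an $(I,J,n)$-DGR. *)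

theory Defs
  imports Main
begin

text \<open>Differences are taken in the integers, since subtraction on the naturals truncates.\<close>

definition golomb_ruler :: "nat set \<Rightarrow> bool" where
  "golomb_ruler S \<longleftrightarrow>
     finite S \<and> inj_on (\<lambda>(a, b). int a - int b) {(a, b). a \<in> S \<and> b \<in> S \<and> a \<noteq> b}"

definition disjoint_golomb_rulers :: "nat \<Rightarrow> nat \<Rightarrow> nat set \<Rightarrow> nat set set \<Rightarrow> bool" where
  "disjoint_golomb_rulers I J A \<R> \<longleftrightarrow>
     finite \<R> \<and> card \<R> = I \<and> pairwise disjnt \<R> \<and>
     (\<forall>S\<in>\<R>. golomb_ruler S \<and> S \<subseteq> A \<and> card S = J)"

definition DGR :: "nat \<Rightarrow> nat \<Rightarrow> nat \<Rightarrow> nat set set \<Rightarrow> bool" where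
  "DGR I J n \<R> \<longleftrightarrow> disjoint_golomb_rulers I J {1..n} \<R>"

text \<open>Meaningful for positive \<open>I\<close> and \<open>J\<close> only; an \<open>(I, J, n)\<close>-DGR then exists for all large \<open>n\<close>.\<close>

definition H :: "nat \<Rightarrow> nat \<Rightarrow> nat" where
  "H I J = (LEAST n. n > 0 \<and> (\<exists>\<R>. DGR I J n \<R>))"

definition assertion_A :: bool where
  "assertion_A \<longleftrightarrow>
     (\<forall>I J :: nat. I > 0 \<longrightarrow> J > 0 \<longrightarrow>
        (\<forall>A :: nat set. finite A \<and> (\<forall>a\<in>A. a > 0) \<and> card A = H I J \<longrightarrow>
           (\<exists>\<R>. disjoint_golomb_rulers I J A \<R>)))"

definition assertion_B :: bool where
  "assertion_B \<longleftrightarrow> (\<forall>I J :: nat. I \<ge> 1 \<longrightarrow> J \<ge> 3 \<longrightarrow> H (I + 1) J \<le> H I J + J)"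

definition assertion_C :: bool where
  "assertion_C \<longleftrightarrow>
     (\<forall>I\<^sub>0 J :: nat. I\<^sub>0 > 0 \<longrightarrow> J > 0 \<longrightarrow> H I\<^sub>0 J = I\<^sub>0 * J \<longrightarrow>
        (\<forall>I :: nat. I > I\<^sub>0 \<longrightarrow> H I J = I * J))"

end

theory Submission
  imports Defs
begin

text \<open>
  A family witnessing \<open>H I J\<close> already contains one ruler in \<open>{1..H I J}\<close>; its complement in
  \<open>{1..H I J + J}\<close> has \<open>H I J\<close> elements, so (A) supplies \<open>I\<close> further rulers there, which is (B).
  Since \<open>I\<close> disjoint rulers occupy \<open>I * J\<close> integers, \<open>I * J \<le> H I J\<close>, and (B) propagates equality
  from \<open>I\<close> to \<open>I + 1\<close>. For \<open>J \<le> 2\<close>, which (B) does not cover, every \<open>J\<close>-set is a ruler and blocks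
  of consecutive integers show \<open>H I J = I * J\<close>.
\<close>

text \<open>Unfolding the pairs into four elements reduces later ruler proofs to linear
  arithmetic.\<close>

lemma golomb_ruler_iff:
  "golomb_ruler S \<longleftrightarrow> finite S \<and>
     (\<forall>a\<in>S. \<forall>b\<in>S. \<forall>c\<in>S. \<forall>d\<in>S. a \<noteq> b \<and> c \<noteq> d \<and> int a - int b = int c - int d \<longrightarrow> a = c \<and> b = d)"
  unfolding golomb_ruler_def inj_on_def by auto

text \<open>Differences within \<open>S\<close> are smaller than \<open>m\<close> in absolute value,
  while those between \<open>2 * m\<close> and an element of \<open>S\<close> exceed
  \<open>m\<close>. Two differences of the latter kind agree only if their signs and their elements
  of \<open>S\<close> agree.\<close>

lemma golomb_ruler_insert_double:
  assumes S: "golomb_ruler S" and less: "\<And>s. s \<in> S \<Longrightarrow> s < m"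
  shows "golomb_ruler (insert (2 * m) S)"
  unfolding golomb_ruler_iff
proof (intro conjI ballI impI)
  show "finite (insert (2 * m) S)"
    using S by (simp add: golomb_ruler_def)
  fix a b c d
  assume mem: "a \<in> insert (2 * m) S" "b \<in> insert (2 * m) S" "c \<in> insert (2 * m) S"
      "d \<in> insert (2 * m) S"
    and eq: "a \<noteq> b \<and> c \<noteq> d \<and> int a - int b = int c - int d"
  have bound: "x = 2 * m \<or> x \<in> S \<and> x < m" if "x \<in> insert (2 * m) S" for x
    using that less by auto
  have "a = c \<and> b = d"
  proof (cases "{a, b, c, d} \<subseteq> S")
    case True
    then show ?thesis using S eq unfolding golomb_ruler_iff by auto
  next
    case False
    then have "a = 2 * m \<or> b = 2 * m \<or> c = 2 * m \<or> d = 2 * m" using mem by auto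
    then show ?thesis
      using bound[OF mem(1)] bound[OF mem(2)] bound[OF mem(3)] bound[OF mem(4)] eq by linarith
  qed
  then show "a = c" "b = d" by simp_all
qed

text \<open>Starting beyond \<open>n\<close> makes the ruler disjoint from any family inside
  \<open>{1..n}\<close>, which lets \<open>ex_DGR\<close> add rulers one at a time.\<close>

lemma ex_golomb_ruler_greater: "\<exists>S. golomb_ruler S \<and> card S = J \<and> (\<forall>s\<in>S. n < s)"
proof (induction J)
  case 0
  show ?case by (rule exI[of _ "{}"]) (simp add: golomb_ruler_iff)
next
  case (Suc J)
  then obtain S where S: "golomb_ruler S" "card S = J" "\<forall>s\<in>S. n < s" by blast
  have fin: "finite S" using S by (simp add: golomb_ruler_def)
  \<comment> \<open>Including \<open>n\<close> keeps the maximum defined for empty \<open>S\<close>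
    and forces \<open>2 * m\<close> beyond \<open>n\<close>.\<close>
  define m where "m = Suc (Max (insert n S))"
  have less: "s < m" if "s \<in> insert n S" for s
    unfolding m_def using that fin by (auto simp: less_Suc_eq_le)
  have "golomb_ruler (insert (2 * m) S)"
    using S(1) less by (intro golomb_ruler_insert_double) auto
  moreover have "2 * m \<notin> S" using less by fastforce
  moreover have "n < 2 * m" using less[of n] by simp
  ultimately show ?case using S fin by (intro exI[of _ "insert (2 * m) S"]) auto
qed

text \<open>Two distinct elements yield just two differences, which are nonzero and opposite, hence
  distinct.\<close>

lemma golomb_ruler_card_le_2:
  assumes "finite S" "card S \<le> 2"
  shows "golomb_ruler S"
proof -
  consider "card S = 0" | "card S = 1" | "card S = 2" using assms by linarith
  then show ?thesis
  proof cases
    case 1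
    then show ?thesis using assms by (simp add: golomb_ruler_iff)
  next
    case 2
    then obtain x where "S = {x}" by (auto simp: card_1_singleton_iff)
    then show ?thesis by (simp add: golomb_ruler_iff)
  next
    case 3
    then obtain x y where "S = {x, y}" by (auto simp: card_2_iff)
    then show ?thesis by (auto simp: golomb_ruler_iff)
  qed
qed

lemma disjoint_golomb_rulers_0: "disjoint_golomb_rulers 0 J A {}"
  by (simp add: disjoint_golomb_rulers_def)

lemma disjoint_golomb_rulers_insert:
  assumes R: "disjoint_golomb_rulers I J A \<R>" and S: "golomb_ruler S" "card S = J"
    and "J > 0" "S \<inter> A = {}"
  shows "disjoint_golomb_rulers (Suc I) J (A \<union> S) (insert S \<R>)"
proof -
  \<comment> \<open>Disjointness alone would allow the empty set to be in the family already; a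
    nonempty \<open>S\<close> is new, so the cardinality really grows.\<close>
  have "S \<noteq> {}" using S(2) \<open>J > 0\<close> by auto
  then have "S \<notin> \<R>" "\<forall>T\<in>\<R>. disjnt S T"
    using R \<open>S \<inter> A = {}\<close> unfolding disjoint_golomb_rulers_def disjnt_def by blast+
  then show ?thesis
    using R S unfolding disjoint_golomb_rulers_def
    by (auto simp: pairwise_insert disjnt_sym)
qed

lemma disjoint_golomb_rulers_mono:
  "disjoint_golomb_rulers I J A \<R> \<Longrightarrow> A \<subseteq> B \<Longrightarrow> disjoint_golomb_rulers I J B \<R>"
  unfolding disjoint_golomb_rulers_def by blast

lemma disjoint_golomb_rulers_card_le:
  assumes R: "disjoint_golomb_rulers I J A \<R>" and "finite A"
  shows "I * J \<le> card A"
proof -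
  have "card (\<Union>\<R>) = (\<Sum>S\<in>\<R>. card S)"
    using R by (intro card_Union_disjoint) (auto simp: disjoint_golomb_rulers_def golomb_ruler_def)
  also have "\<dots> = I * J"
    using R by (simp add: disjoint_golomb_rulers_def)
  finally show ?thesis
    using R \<open>finite A\<close> card_mono[of A "\<Union>\<R>"] by (auto simp: disjoint_golomb_rulers_def)
qed

text \<open>This makes the \<open>LEAST\<close> in \<open>H\<close> an attained minimum.\<close>

lemma ex_DGR:
  assumes "J > 0"
  shows "\<exists>n>0. \<exists>\<R>. DGR I J n \<R>"
proof (induction I)
  case 0
  show ?case using disjoint_golomb_rulers_0 by (auto simp: DGR_def)
next
  case (Suc I)
  then obtain n \<R> where R: "disjoint_golomb_rulers I J {1..n} \<R>" by (auto simp: DGR_def)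
  obtain S where S: "golomb_ruler S" "card S = J" "\<forall>s\<in>S. n < s"
    using ex_golomb_ruler_greater by blast
  have "S \<inter> {1..n} = {}" using S by auto
  note R' = disjoint_golomb_rulers_insert[OF R S(1,2) assms this]
  \<comment> \<open>\<open>Suc n\<close> ensures both that \<open>{1..n}\<close> fits below
    \<open>m\<close> and that \<open>m\<close> is positive.\<close>
  define m where "m = Max (insert (Suc n) S)"
  have le: "s \<le> m" if "s \<in> insert (Suc n) S" for s
    unfolding m_def using that S by (auto simp: golomb_ruler_def)
  have "{1..n} \<union> S \<subseteq> {1..m}"
    using S(3) le le[of "Suc n"] by fastforce
  then have "DGR (Suc I) J m (insert S \<R>)"
    unfolding DGR_def by (rule disjoint_golomb_rulers_mono[OF R'])
  moreover have "m > 0" using le[of "Suc n"] by simp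
  ultimately show ?case by blast
qed

lemma DGR_H:
  assumes "J > 0"
  obtains \<R> where "DGR I J (H I J) \<R>"
proof -
  have "H I J > 0 \<and> (\<exists>\<R>. DGR I J (H I J) \<R>)"
    unfolding H_def using ex_DGR[OF assms] by (rule LeastI_ex)
  then show ?thesis using that by blast
qed

lemma H_le: "n > 0 \<Longrightarrow> DGR I J n \<R> \<Longrightarrow> H I J \<le> n"
  unfolding H_def by (rule Least_le) blast

lemma mult_le_H:
  assumes "J > 0"
  shows "I * J \<le> H I J"
proof -
  obtain \<R> where "DGR I J (H I J) \<R>" using DGR_H[OF assms] .
  then show ?thesis using disjoint_golomb_rulers_card_le by (fastforce simp: DGR_def)
qed

lemma H_le_2:
  assumes "I > 0" "J > 0" "J \<le> 2"
  shows "H I J = I * J"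
proof -
  have "\<exists>\<R>. disjoint_golomb_rulers I J {1..I * J} \<R>"
  proof (induction I)
    case 0
    show ?case using disjoint_golomb_rulers_0 by blast
  next
    case (Suc I)
    then obtain \<R> where R: "disjoint_golomb_rulers I J {1..I * J} \<R>" by blast
    have "golomb_ruler {I * J + 1..I * J + J}"
      using \<open>J \<le> 2\<close> by (intro golomb_ruler_card_le_2) auto
    from disjoint_golomb_rulers_insert[OF R this _ \<open>J > 0\<close>]
    have "disjoint_golomb_rulers (Suc I) J ({1..I * J} \<union> {I * J + 1..I * J + J})
        (insert {I * J + 1..I * J + J} \<R>)"
      by auto
    moreover have "{1..I * J} \<union> {I * J + 1..I * J + J} = {1..Suc I * J}" by auto
    ultimately show ?case by metis
  qed
  \<comment> \<open>\<open>H\<close> minimises over positive integers only, so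
    \<open>I * J > 0\<close> is needed here; the induction itself could start from the empty
    family.\<close>
  then have "H I J \<le> I * J"
    using assms by (auto simp: DGR_def intro: H_le)
  then show ?thesis using mult_le_H[OF \<open>J > 0\<close>, of I] by simp
qed

lemma H_Suc_le_if_assertion_A:
  assumes A: assertion_A and "I > 0" "J > 0"
  shows "H (Suc I) J \<le> H I J + J"
proof -
  obtain \<R> where R: "DGR I J (H I J) \<R>" using DGR_H[OF \<open>J > 0\<close>] .
  with \<open>I > 0\<close> have "\<R> \<noteq> {}" by (auto simp: DGR_def disjoint_golomb_rulers_def)
  with R obtain S where S: "golomb_ruler S" "S \<subseteq> {1..H I J}" "card S = J"
    unfolding DGR_def disjoint_golomb_rulers_def by blast
  let ?U = "{1..H I J + J}"
  have sub: "S \<subseteq> ?U" using S(2) by auto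
  \<comment> \<open>The complement need not be an interval, so the definition of \<open>H\<close>
    gives no rulers in it; (A) asks only for its cardinality.\<close>
  have "card (?U - S) = H I J"
    using sub S(3) by (simp add: card_Diff_subset finite_subset)
  then obtain \<Q> where "disjoint_golomb_rulers I J (?U - S) \<Q>"
    using A \<open>I > 0\<close> \<open>J > 0\<close> unfolding assertion_A_def by fastforce
  from disjoint_golomb_rulers_insert[OF this S(1,3) \<open>J > 0\<close>]
  have "disjoint_golomb_rulers (Suc I) J ?U (insert S \<Q>)"
    using sub by (simp add: Un_absorb2)
  then show ?thesis
    using \<open>J > 0\<close> by (intro H_le) (auto simp: DGR_def)
qed

lemma assertion_C_if_assertion_B:
  assumes B: assertion_B
  shows assertion_C
  unfolding assertion_C_def
proof (intro allI impI)
  fix I\<^sub>0 J I :: nat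
  assume pos: "I\<^sub>0 > 0" "J > 0" and H0: "H I\<^sub>0 J = I\<^sub>0 * J" and "I > I\<^sub>0"
  show "H I J = I * J"
  proof (cases "J \<le> 2")
    case True
    then show ?thesis using pos \<open>I > I\<^sub>0\<close> by (intro H_le_2) auto
  next
    case False
    from \<open>I > I\<^sub>0\<close> have "I\<^sub>0 \<le> I" by simp
    then show ?thesis
    proof (induction I rule: dec_induct)
      case base
      show ?case by (fact H0)
    next
      case (step k)
      \<comment> \<open>(B) needs \<open>k \<ge> 1\<close>, which follows from
        \<open>0 < I\<^sub>0 \<le> k\<close>. By the induction hypothesis the right-hand side is
        \<open>Suc k * J\<close>, matching the counting bound.\<close>
      have "H (k + 1) J \<le> H k J + J"
        using B False pos step.hyps unfolding assertion_B_def
        by simp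
      with step.IH mult_le_H[OF \<open>J > 0\<close>, of "Suc k"] show ?case by simp
    qed
  qed
qed

theorem theorem2:
  shows "(assertion_A \<longrightarrow> assertion_B) \<and>
         (assertion_B \<longrightarrow> assertion_C) \<and>
         (assertion_A \<longrightarrow> assertion_C)"
proof -
  have "assertion_A \<longrightarrow> assertion_B"
    using H_Suc_le_if_assertion_A unfolding assertion_B_def by auto
  then show ?thesis using assertion_C_if_assertion_B by blast
qed

end
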